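(* Let $r>0$, $r\ne1$. Provided that there exists $k\in\{1,2,\dots,K\}$ with $p_k\ne1/K$, as $n\to\infty$, $$\sqrt n\left(\hat H_r^\sharp(n)-H_r\right)h_r(1-r)\left[g^\tau(\mathbf v)\Sigma(\mathbf v)g(\mathbf v)\right]^{-1/2}\stackrel{L}{\rightarrow}N(0,1).$$
   Context: Let $\mathbf p=(p_1,\dots,p_K)$ be a probability distribution on letters $\ell_1,\dots,\ell_K$ with $K<\infty$ and $p_k>0$ for $k=1,\dots,K$. Let $h_r=\sum_{k=1}^Kp_k^r$ (Rényi's equivalent entropy) and $H_r=(1-r)^{-1}\ln h_r$ (Rényi's entropy). Let $X_1,X_2,\dots$ be i.i.d. with $P(X_1=\ell_k)=p_k$. For a sample of size $n$ let $x_k=\sum_{i=1}^n1[X_i=\ell_k]$ and $\hat p_k=x_k/n$. Define $$\hat h_r^\sharp(n)=1+\sum_{k=1}^K\hat p_k\sum_{v=1}^{n-x_k}w_v\prod_{j=1}^v\left(1-\frac{x_k-1}{n-j}\right),\qquad w_v=\prod_{i=1}^v\frac{i-r}{i}\quad(v\ge1),$$ where the $k$-th summand is $0$ when $x_k=0$, and $$\hat H_r^\sharp(n)=\frac{\ln\hat h_r^\sharp(n)}{1-r},$$ where $\hat H_r^\sharp(n)$ may be given an arbitrary value (e.g. $0$) if $\hat h_r^\sharp(n)\le0$. Let $\mathbf v=(p_1,\dots,p_{K-1})^\tau$ ($\tau$ denotes transpose), and let $\Sigma(\mathbf v)$ be the $(K-1)\times(K-1)$ matrix with diagonal entries $p_i(1-p_i)$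 and off-diagonal entries $-p_ip_j$. Let $G(\mathbf v)=\sum_{k=1}^{K-1}p_k^r+\big(1-\sum_{k=1}^{K-1}p_k\big)^r$ and $g(\mathbf v)=\nabla G(\mathbf v)$, i.e. the $j$-th component of $g(\mathbf v)$ is $r p_j^{r-1}-r p_K^{r-1}$. $\stackrel{L}{\rightarrow}$ denotes convergence in law. *)

theory Defs
  imports "HOL-Probability.Probability"
begin

text \<open>
  A distribution on \<open>K\<close> letters is given by \<open>p :: nat \<Rightarrow> real\<close>, read on the indices \<open>{1..K}\<close>.
  Vectors and matrices of dimension \<open>K - 1\<close> are functions on \<open>{1..K-1}\<close>; in particular the
  vector \<open>(p\<^sub>1, \<dots>, p\<^bsub>K-1\<^esub>)\<close> is \<open>p\<close> itself, of which only these coordinates are read.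
\<close>

definition renyi_equiv_entropy :: "nat \<Rightarrow> real \<Rightarrow> (nat \<Rightarrow> real) \<Rightarrow> real" where
  "renyi_equiv_entropy K r p = (\<Sum>k=1..K. p k powr r)"

definition renyi_entropy :: "nat \<Rightarrow> real \<Rightarrow> (nat \<Rightarrow> real) \<Rightarrow> real" where
  "renyi_entropy K r p = inverse (1 - r) * ln (renyi_equiv_entropy K r p)"

definition letter_count :: "(nat \<Rightarrow> 'w \<Rightarrow> 'a) \<Rightarrow> nat \<Rightarrow> 'a \<Rightarrow> 'w \<Rightarrow> nat" where
  "letter_count X n a \<omega> = (\<Sum>i=1..n. of_bool (X i \<omega> = a))"

definition w_coeff :: "real \<Rightarrow> nat \<Rightarrow> real" where
  "w_coeff r v = (\<Prod>i=1..v. (real i - r) / real i)"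

text \<open>
  The argument \<open>x\<close> is the vector of letter counts. If \<open>x k = 0\<close>, the \<open>k\<close>-th summand vanishes
  because of its first factor, so the division by zero in the inner product at \<open>j = n\<close> is harmless;
  if \<open>x k > 0\<close>, all \<open>j\<close> occurring are less than \<open>n\<close>.
\<close>

definition h_sharp :: "nat \<Rightarrow> real \<Rightarrow> nat \<Rightarrow> (nat \<Rightarrow> nat) \<Rightarrow> real" where
  "h_sharp K r n x =
     1 + (\<Sum>k=1..K. real (x k) / real n *
            (\<Sum>v=1..n - x k. w_coeff r v *
               (\<Prod>j=1..v. 1 - (real (x k) - 1) / (real n - real j))))"

text \<open>The argument \<open>c\<close> is the arbitrary value used when the logarithm is not defined.\<close>

definition H_sharp :: "nat \<Rightarrow> real \<Rightarrow> nat \<Rightarrow> (nat \<Rightarrow> nat) \<Rightarrow> real \<Rightarrow> real" where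
  "H_sharp K r n x c = (if h_sharp K r n x > 0 then ln (h_sharp K r n x) / (1 - r) else c)"

definition Sigma_mat :: "(nat \<Rightarrow> real) \<Rightarrow> nat \<Rightarrow> nat \<Rightarrow> real" where
  "Sigma_mat v i j = (if i = j then v i * (1 - v i) else - (v i * v j))"

definition G_fun :: "nat \<Rightarrow> real \<Rightarrow> (nat \<Rightarrow> real) \<Rightarrow> real" where
  "G_fun K r v = (\<Sum>k=1..K-1. v k powr r) + (1 - (\<Sum>k=1..K-1. v k)) powr r"

text \<open>The gradient, given by its components, the partial derivatives.\<close>

definition g_grad :: "nat \<Rightarrow> real \<Rightarrow> (nat \<Rightarrow> real) \<Rightarrow> nat \<Rightarrow> real" where
  "g_grad K r v j = deriv (\<lambda>t. G_fun K r (v(j := t))) (v j)"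

lemma g_grad_eq:
  assumes sum1: "(\<Sum>k=1..K. p k) = 1" and pos: "\<And>k. k \<in> {1..K} \<Longrightarrow> p k > 0"
    and j: "j \<in> {1..K-1}"
  shows "g_grad K r p j = r * p j powr (r - 1) - r * p K powr (r - 1)"
proof -
  let ?A = "{1..K-1} - {j}"
  have K: "K = Suc (K - 1)" using j by auto
  have "(\<Sum>k=1..K. p k) = (\<Sum>k=1..K-1. p k) + p K"
    by (subst K, subst sum.cl_ivl_Suc) (use K in auto)
  moreover have "(\<Sum>k=1..K-1. p k) = p j + sum p ?A"
    using j by (simp add: sum.remove)
  ultimately have pK: "1 - (p j + sum p ?A) = p K" using sum1 by simp
  have G: "(\<lambda>t. G_fun K r (p(j := t))) =
      (\<lambda>t. t powr r + (\<Sum>k\<in>?A. p k powr r) + (1 - (t + sum p ?A)) powr r)"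
    using j by (auto simp: G_fun_def sum.remove[of _ j] fun_eq_iff)
  have der: "((\<lambda>t. t powr r + C + (1 - (t + S)) powr r)
      has_field_derivative (r * x powr (r - 1) - r * y powr (r - 1))) (at x)"
    if "x > 0" "y > 0" "y = 1 - (x + S)" for x y C S :: real
    using that by (auto intro!: derivative_eq_intros)
  have "p j > 0" "p K > 0" using pos j by auto
  then show ?thesis
    unfolding g_grad_def G by (intro DERIV_imp_deriv der pK[symmetric])
qed

end

theory Submission
  imports Defs "HOL-Real_Asymp.Real_Asymp"
begin

text \<open>
  By Chu--Vandermonde one plus the inner sum of the estimator (a terminating hypergeometric
  series at 1) equals
  \<open>\<Prod>\<^bsub>x < l \<le> n\<^esub> (l - r) / (l - 1) = (x / n)\<^bsup>r-1\<^esup> (1 + O(1 / x))\<close>, so the estimator differs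
  from the plug-in estimator \<open>\<Sum>\<^sub>k (x\<^sub>k / n)\<^sup>r\<close> by \<open>O(1 / n)\<close> as long as all \<open>x\<^sub>k / n\<close> stay near \<open>p\<^sub>k\<close>.
  Linearising power and logarithm turns the normalised error into a sum of i.i.d. variables
  \<open>r p(X\<^sub>i)\<^bsup>r-1\<^esup>\<close>, up to a remainder that vanishes in probability because
  \<open>x\<^sub>k / n - p\<^sub>k\<close> has second moment at most \<open>1 / n\<close>. The variance of these variables is the quadratic form
  \<open>g\<^sup>\<tau> \<Sigma> g\<close>, which is positive unless \<open>p\<close> is uniform, and the central limit theorem applies.
\<close>

section \<open>Stability of convergence in law under small perturbations\<close>

lemma iexp_dist_le: "cmod (iexp a - iexp b) \<le> \<bar>a - b\<bar>"
proof -
  have "iexp a - iexp b = iexp b * (iexp (a - b) - 1)"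
    by (simp add: algebra_simps flip: exp_add)
  then have "cmod (iexp a - iexp b) = cmod (iexp (a - b) - 1)"
    by (simp add: norm_mult)
  also have "\<dots> \<le> \<bar>a - b\<bar>"
    using iexp_approx1[of "a - b" 0] by simp
  finally show ?thesis .
qed

text \<open>A form of Slutsky's theorem, via characteristic functions and Levy's continuity theorem.
  The truncation at 1 makes \<open>close\<close> express that the difference vanishes in
  probability: no integrability of \<open>T n\<close> is required, and a rare event on which
  \<open>T n\<close> is out of control costs at most its probability.\<close>

lemma (in prob_space) weak_conv_m_perturb:
  fixes S T :: "nat \<Rightarrow> 'a \<Rightarrow> real"
  assumes S [measurable]: "\<And>n. S n \<in> borel_measurable M"
    and T [measurable]: "\<And>n. T n \<in> borel_measurable M"
    and N: "real_distribution N"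
    and conv: "weak_conv_m (\<lambda>n. distr M borel (S n)) N"
    and close: "(\<lambda>n. expectation (\<lambda>\<omega>. min 1 \<bar>T n \<omega> - S n \<omega>\<bar>)) \<longlonglongrightarrow> 0"
  shows "weak_conv_m (\<lambda>n. distr M borel (T n)) N"
proof (rule levy_continuity[OF _ N])
  show "real_distribution (distr M borel (T n))" for n
    by (rule real_distribution_distr) simp
  fix t :: real
  let ?c = "\<lambda>Y n. char (distr M borel (Y n)) t"
  have char_eq: "?c Y n = expectation (\<lambda>\<omega>. iexp (t * Y n \<omega>))"
    if "\<And>n. Y n \<in> borel_measurable M" for Y n
    unfolding char_def using that by (simp add: integral_distr)
  have int: "integrable M (\<lambda>\<omega>. iexp (t * Y n \<omega>))"
    if [measurable]: "\<And>n. Y n \<in> borel_measurable M" for Y n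
    by (rule integrable_iexp) auto
  \<comment> \<open>The constant merges two bounds on the integrand: the Lipschitz bound with factor
    \<open>\<bar>t\<bar>\<close> where the truncation is inactive, and the trivial bound 2 where the
    minimum equals 1.\<close>
  have bound: "cmod (?c T n - ?c S n)
      \<le> (2 + \<bar>t\<bar>) * expectation (\<lambda>\<omega>. min 1 \<bar>T n \<omega> - S n \<omega>\<bar>)" for n
  proof -
    have "cmod (?c T n - ?c S n)
        = cmod (expectation (\<lambda>\<omega>. iexp (t * T n \<omega>) - iexp (t * S n \<omega>)))"
      unfolding char_eq[of T, OF T] char_eq[of S, OF S]
      by (rule arg_cong[where f = cmod],
          rule Bochner_Integration.integral_diff[symmetric, OF int[of T, OF T] int[of S, OF S]])
    also have "\<dots> \<le> expectation (\<lambda>\<omega>. cmod (iexp (t * T n \<omega>) - iexp (t * S n \<omega>)))"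
      by (rule integral_norm_bound)
    also have "\<dots> \<le> expectation (\<lambda>\<omega>. (2 + \<bar>t\<bar>) * min 1 \<bar>T n \<omega> - S n \<omega>\<bar>)"
    proof (rule integral_mono)
      show "integrable M (\<lambda>\<omega>. cmod (iexp (t * T n \<omega>) - iexp (t * S n \<omega>)))"
        using int[of T, OF T] int[of S, OF S] by (intro integrable_norm) simp
      show "integrable M (\<lambda>\<omega>. (2 + \<bar>t\<bar>) * min 1 \<bar>T n \<omega> - S n \<omega>\<bar>)"
        by (intro integrable_mult_right integrable_const_bound[where B = 1]) auto
      fix \<omega>
      have "cmod (iexp (t * T n \<omega>) - iexp (t * S n \<omega>)) \<le> \<bar>t * T n \<omega> - t * S n \<omega>\<bar>"
        by (rule iexp_dist_le)
      then have 1: "cmod (iexp (t * T n \<omega>) - iexp (t * S n \<omega>)) \<le> \<bar>t\<bar> * \<bar>T n \<omega> - S n \<omega>\<bar>"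
        by (simp flip: right_diff_distrib abs_mult)
      have "cmod (iexp (t * T n \<omega>) - iexp (t * S n \<omega>))
          \<le> cmod (iexp (t * T n \<omega>)) + cmod (iexp (t * S n \<omega>))"
        by (rule norm_triangle_ineq4)
      then have 2: "cmod (iexp (t * T n \<omega>) - iexp (t * S n \<omega>)) \<le> 2"
        by (simp del: of_real_mult)
      show "cmod (iexp (t * T n \<omega>) - iexp (t * S n \<omega>))
          \<le> (2 + \<bar>t\<bar>) * min 1 \<bar>T n \<omega> - S n \<omega>\<bar>"
      proof (cases "\<bar>T n \<omega> - S n \<omega>\<bar> \<le> 1")
        case True
        note 1
        also have "\<bar>t\<bar> * \<bar>T n \<omega> - S n \<omega>\<bar> \<le> (2 + \<bar>t\<bar>) * \<bar>T n \<omega> - S n \<omega>\<bar>"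
          by (intro mult_right_mono) auto
        also have "\<bar>T n \<omega> - S n \<omega>\<bar> = min 1 \<bar>T n \<omega> - S n \<omega>\<bar>" using True by simp
        finally show ?thesis .
      next
        case False
        then show ?thesis using 2 by simp
      qed
    qed
    finally show ?thesis by simp
  qed
  have "(\<lambda>n. (2 + \<bar>t\<bar>) * expectation (\<lambda>\<omega>. min 1 \<bar>T n \<omega> - S n \<omega>\<bar>)) \<longlonglongrightarrow> 0"
    using tendsto_mult_left[OF close, of "2 + \<bar>t\<bar>"] by simp
  then have "(\<lambda>n. ?c T n - ?c S n) \<longlonglongrightarrow> 0"
    by (rule Lim_null_comparison[OF always_eventually, rotated]) (use bound in blast)
  moreover have "(\<lambda>n. ?c S n) \<longlonglongrightarrow> char N t"
    by (rule levy_continuity1[OF real_distribution_distr N conv]) simp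
  ultimately show "(\<lambda>n. ?c T n) \<longlonglongrightarrow> char N t"
    using tendsto_add by fastforce
qed

section \<open>Closed form of the inner sum\<close>

lemma w_coeff_pochhammer: "w_coeff r v = pochhammer (1 - r) v / fact v"
proof (induction v)
  case (Suc v)
  have "w_coeff r (Suc v) = w_coeff r v * ((real (Suc v) - r) / real (Suc v))"
    by (simp add: w_coeff_def)
  then show ?case
    using Suc.IH by (simp add: pochhammer_Suc field_simps)
qed (simp add: w_coeff_def)

lemma pochhammer_divide_eq_prod:
  fixes r :: real
  assumes "x \<ge> 1"
  shows "pochhammer (real x + 1 - r) m / pochhammer (real x) m
    = (\<Prod>l\<in>{x<..x + m}. (real l - r) / (real l - 1))"
proof (induction m)
  case (Suc m)
  have "{x<..x + Suc m} = insert (x + Suc m) {x<..x + m}" by auto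
  then have "(\<Prod>l\<in>{x<..x + Suc m}. (real l - r) / (real l - 1))
      = (real x + 1 - r + real m) / (real x + real m)
        * (\<Prod>l\<in>{x<..x + m}. (real l - r) / (real l - 1))"
    by (simp add: algebra_simps)
  then show ?case unfolding Suc.IH[symmetric] by (simp add: pochhammer_Suc mult.commute)
qed simp

text \<open>Write (a)_m for rising factorials and m = n - x. The coefficient is (1 - r)_v / v! and
  the inner product is v! (m choose v) (x)_(m-v) / (x)_m. The factorials cancel, the leading 1 is
  the term v = 0, and Vandermonde's identity sums everything to (x + 1 - r)_m / (x)_m.\<close>

lemma h_sharp_inner_sum:
  assumes x: "1 \<le> x" "x \<le> n"
  shows "1 + (\<Sum>v=1..n - x. w_coeff r v * (\<Prod>j=1..v. 1 - (real x - 1) / (real n - real j)))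
    = (\<Prod>l\<in>{x<..n}. (real l - r) / (real l - 1))"
proof -
  define m where "m = n - x"
  have n: "n = x + m" using x by (simp add: m_def)
  let ?P = "\<lambda>v. \<Prod>j=1..v. 1 - (real x - 1) / (real n - real j)"
  have pos: "pochhammer (real x) m > 0" using x by (intro pochhammer_pos) simp
  \<comment> \<open>The denominator is cleared for the induction. Passing from v to v + 1 trades the
    last factor x + u of the rising factorial for u + 1, which turns the binomial coefficient into
    the next one.\<close>
  have P: "?P v * pochhammer (real x) m
      = fact v * real (m choose v) * pochhammer (real x) (m - v)" if "v \<le> m" for v
    using that
  proof (induction v)
    case (Suc v)
    then have mv: "m - v = Suc (m - Suc v)" by simp
    define u where "u = m - Suc v"
    have m: "m = u + Suc v" using Suc.prems by (simp add: u_def)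
    have den: "real x + real u > 0" using x by simp
    \<comment> \<open>Both sides equal m times (m - 1 choose v).\<close>
    have "Suc v * (m choose Suc v) = Suc u * (m choose v)"
      using binomial_absorption[of v m] binomial_absorb_comp[of m v] mv by (simp only: u_def)
    then have ch: "real (Suc v) * real (m choose Suc v) = real (Suc u) * real (m choose v)"
      by (simp only: flip: of_nat_mult)
    have "?P (Suc v) * pochhammer (real x) m
        = (?P v * pochhammer (real x) m) * (1 - (real x - 1) / (real n - real (Suc v)))"
      by simp
    also have "?P v * pochhammer (real x) m
        = fact v * real (m choose v) * (pochhammer (real x) u * (real x + real u))"
      using Suc mv by (simp add: pochhammer_Suc u_def)
    also have "1 - (real x - 1) / (real n - real (Suc v)) = real (Suc u) / (real x + real u)"
      using den by (simp add: n m field_simps)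
    also have "fact v * real (m choose v) * (pochhammer (real x) u * (real x + real u))
          * (real (Suc u) / (real x + real u))
        = fact v * (real (Suc u) * real (m choose v)) * pochhammer (real x) u"
      using den by simp
    also have "\<dots> = fact (Suc v) * real (m choose Suc v) * pochhammer (real x) (m - Suc v)"
      unfolding ch[symmetric] by (simp add: u_def)
    finally show ?case .
  qed simp
  have "1 + (\<Sum>v=1..m. w_coeff r v * ?P v) = (\<Sum>v\<le>m. w_coeff r v * ?P v)"
    by (simp add: atMost_atLeast0 sum.atLeast_Suc_atMost w_coeff_def)
  also have "\<dots> = (\<Sum>v\<le>m. real (m choose v) * pochhammer (1 - r) v * pochhammer (real x) (m - v)
      / pochhammer (real x) m)"
  proof (rule sum.cong[OF refl])
    fix v assume "v \<in> {..m}"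
    then have "?P v = fact v * real (m choose v) * pochhammer (real x) (m - v)
        / pochhammer (real x) m"
      using P[of v] pos by (simp add: field_simps)
    then show "w_coeff r v * ?P v = real (m choose v) * pochhammer (1 - r) v
        * pochhammer (real x) (m - v) / pochhammer (real x) m"
      by (simp add: w_coeff_pochhammer)
  qed
  also have "\<dots> = pochhammer (1 - r + real x) m / pochhammer (real x) m"
    by (simp add: pochhammer_binomial_sum sum_divide_distrib)
  also have "1 - r + real x = real x + 1 - r" by simp
  finally show ?thesis
    using pochhammer_divide_eq_prod[OF x(1)] by (simp add: n)
qed

section \<open>Comparison with the plug-in estimator and linearisation\<close>

text \<open>The powers (l / (l - 1))^(r-1) telescope to (n / x)^(r-1), and each factor of the
  product is the reciprocal of such a power up to a relative error O(1 / l^2). The logarithms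
  \<open>ln (a l)\<close> of these errors add up to O(1 / x) beyond x, uniformly in n.\<close>

lemma prod_shifted_ratio_asymp:
  fixes r :: real
  obtains C L where "C > 0" "L > 0"
    "\<And>x n. real x \<ge> L \<Longrightarrow> x \<le> n \<Longrightarrow>
      \<bar>(\<Prod>l\<in>{x<..n}. (real l - r) / (real l - 1)) - (real x / real n) powr (r - 1)\<bar>
      \<le> (real x / real n) powr (r - 1) * (C / real x)"
proof -
  define a :: "nat \<Rightarrow> real" where
    "a l = (real l - r) / (real l - 1) * (real l / (real l - 1)) powr (r - 1)" for l
  \<comment> \<open>The comparison function equals 1 / (l (l - 1)). As a difference it sums to 1 / x
    - 1 / n over x < l \<le> n.\<close>
  have "(\<lambda>l. ln (a l)) \<in> O(\<lambda>l. 1 / (real l - 1) - 1 / real l)"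
    unfolding a_def by real_asymp
  then obtain C0 where C0: "C0 > 0"
    "\<forall>\<^sub>F l in sequentially. norm (ln (a l)) \<le> C0 * norm (1 / (real l - 1) - 1 / real l)"
    by (elim landau_o.bigE)
  then obtain L0 where L0:
    "\<And>l. l \<ge> L0 \<Longrightarrow> norm (ln (a l)) \<le> C0 * norm (1 / (real l - 1) - 1 / real l)"
    by (auto simp: eventually_sequentially)
  \<comment> \<open>\<open>L0\<close> makes the bound on \<open>ln (a l)\<close> available,
    \<open>C0\<close> keeps the total exponent \<open>s\<close> in [-1, 1], and
    \<open>\<bar>r\<bar> + 1\<close> keeps the factors positive, so that \<open>exp\<close> undoes
    \<open>ln\<close>.\<close>
  define L where "L = max (max (real L0) C0) (\<bar>r\<bar> + 1)"
  show ?thesis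
  proof (rule that[of "2 * C0" L])
    show "2 * C0 > 0" "L > 0" using C0 by (auto simp: L_def)
    fix x n :: nat
    assume x: "real x \<ge> L" and n: "x \<le> n"
    have x1: "real x \<ge> 1" "real x \<ge> r" "x \<ge> L0" "real x \<ge> C0" using x by (auto simp: L_def)
    then have xpos: "real x > 0" by linarith
    let ?s = "\<lambda>n. \<Sum>l\<in>{x<..n}. ln (a l)"
    \<comment> \<open>In the induction step, the power inside \<open>a (Suc n)\<close> converts (x /
      (n + 1))^(r-1) back into (x / n)^(r-1).\<close>
    have P: "(\<Prod>l\<in>{x<..n}. (real l - r) / (real l - 1)) = (real x / real n) powr (r - 1) * exp (?s n)
        \<and> \<bar>?s n\<bar> \<le> C0 * (1 / real x - 1 / real n)"
      using n
    proof (induction n rule: dec_induct)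
      case (step n)
      have ins: "{x<..Suc n} = insert (Suc n) {x<..n}" using step by auto
      have npos: "real n > 0" "real n \<ge> real x" using step xpos by auto
      have "real (Suc n) - r > 0" using npos x1 by simp
      then have "exp (ln (a (Suc n))) = a (Suc n)"
        using npos by (subst exp_ln) (auto simp: a_def intro!: mult_pos_pos divide_pos_pos)
      moreover have "(real x / real (Suc n)) powr (r - 1) * (real (Suc n) / real n) powr (r - 1)
          = (real x / real n) powr (r - 1)"
        using npos by (subst powr_mult[symmetric]) auto
      ultimately have A: "(real x / real (Suc n)) powr (r - 1) * exp (ln (a (Suc n)))
          = (real x / real n) powr (r - 1) * ((real (Suc n) - r) / real n)"
        by (simp add: a_def mult.left_commute mult.commute)
      have "\<bar>ln (a (Suc n))\<bar> \<le> C0 * (1 / real n - 1 / real (Suc n))"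
      proof -
        have "1 / real n - 1 / real (Suc n) \<ge> 0" using npos by (simp add: field_simps)
        then show ?thesis using L0[of "Suc n"] step x1 by simp
      qed
      then have "\<bar>?s (Suc n)\<bar> \<le> C0 * (1 / real x - 1 / real (Suc n))"
        using step.IH abs_triangle_ineq[of "ln (a (Suc n))" "?s n"]
        by (simp add: ins right_diff_distrib)
      then show ?case
        using step.IH arg_cong[OF A, of "\<lambda>z. z * exp (?s n)"] by (simp add: ins exp_add mult_ac)
    qed (use xpos in simp)
    define s where "s = ?s n"
    define q where "q = (real x / real n) powr (r - 1)"
    have "\<bar>s\<bar> \<le> C0 * (1 / real x - 1 / real n)" using P by (simp add: s_def)
    also have "\<dots> \<le> C0 / real x" using C0 by (simp add: field_simps)
    finally have s: "\<bar>s\<bar> \<le> C0 / real x" .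
    also have "\<dots> \<le> 1" using x1 xpos by simp
    finally have s1: "\<bar>s\<bar> \<le> 1" .
    have "\<bar>exp s - 1\<bar> \<le> 2 * \<bar>s\<bar>"
    proof (cases "s \<ge> 0")
      case True
      have "s\<^sup>2 \<le> s" using True s1 by (simp add: power2_eq_square mult_left_le)
      then show ?thesis using exp_bound[of s] True s1 by simp
    next
      case False
      then have "exp s \<le> 1" "s < 0" by simp_all
      then show ?thesis using exp_ge_add_one_self[of s] by linarith
    qed
    then have e: "\<bar>exp s - 1\<bar> \<le> 2 * C0 / real x" using s by simp
    have "q * exp s - q = q * (exp s - 1)" by (simp add: right_diff_distrib)
    then have "\<bar>q * exp s - q\<bar> = q * \<bar>exp s - 1\<bar>"
      by (simp add: abs_mult q_def)
    also have "\<dots> \<le> q * (2 * C0 / real x)"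
      using e by (intro mult_left_mono) (simp_all add: q_def)
    finally show "\<bar>(\<Prod>l\<in>{x<..n}. (real l - r) / (real l - 1)) - (real x / real n) powr (r - 1)\<bar>
        \<le> (real x / real n) powr (r - 1) * (2 * C0 / real x)"
      using P by (simp add: s_def q_def)
  qed
qed

text \<open>The share of a letter seen x times in the estimator. The first factor makes it 0 for an
  unseen letter.\<close>

definition turing_term :: "real \<Rightarrow> nat \<Rightarrow> nat \<Rightarrow> real" where
  "turing_term r n x = real x / real n * (\<Prod>l\<in>{x<..n}. (real l - r) / (real l - 1))"

text \<open>The relative frequencies sum to 1, so the leading 1 of the estimator can be distributed
  over the letters with these weights; each inner sum then takes its closed form.\<close>

lemma h_sharp_eq_sum_turing_term:
  assumes n: "n > 0" and x: "(\<Sum>k=1..K. x k) = n"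
  shows "h_sharp K r n x = (\<Sum>k=1..K. turing_term r n (x k))"
proof -
  have "(\<Sum>k=1..K. real (x k) / real n) = 1"
    unfolding sum_divide_distrib[symmetric] of_nat_sum[symmetric] x using n by simp
  then have "h_sharp K r n x = (\<Sum>k=1..K. real (x k) / real n *
      (1 + (\<Sum>v=1..n - x k. w_coeff r v * (\<Prod>j=1..v. 1 - (real (x k) - 1) / (real n - real j)))))"
    by (simp add: h_sharp_def distrib_left sum.distrib)
  also have "\<dots> = (\<Sum>k=1..K. turing_term r n (x k))"
  proof (rule sum.cong[OF refl])
    fix k assume "k \<in> {1..K}"
    then have "x k \<le> n" unfolding x[symmetric] by (intro member_le_sum) auto
    then show "real (x k) / real n *
      (1 + (\<Sum>v=1..n - x k. w_coeff r v * (\<Prod>j=1..v. 1 - (real (x k) - 1) / (real n - real j))))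
      = turing_term r n (x k)"
      using h_sharp_inner_sum[of "x k" n r] by (cases "x k = 0") (auto simp: turing_term_def)
  qed
  finally show ?thesis .
qed

text \<open>With q = x / n near p, the term differs from q^r by at most C / x = O(1 / n), and q^r is
  differentiable at p. The error is measured against 1 / sqrt n because everything is later scaled
  by sqrt n. Quantifying over all small \<open>\<eta>\<close> lets the requirements of finitely many
  letters be met at once.\<close>

lemma turing_term_expansion:
  fixes r p \<epsilon> :: real
  assumes p: "p > 0" and r: "r > 0" and \<epsilon>: "\<epsilon> > 0"
  shows "\<forall>\<^sub>F \<eta> in at_right 0. \<forall>\<^sub>F n in sequentially. \<forall>x\<le>n. \<bar>real x / real n - p\<bar> \<le> \<eta> \<longrightarrow>
    \<bar>turing_term r n x - p powr r - r * p powr (r - 1) * (real x / real n - p)\<bar>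
      \<le> \<epsilon> * (\<bar>real x / real n - p\<bar> + 1 / sqrt (real n))"
proof -
  have "((\<lambda>q. q powr r) has_real_derivative r * p powr (r - 1)) (at p)"
    using p by (auto intro!: derivative_eq_intros)
  then have "((\<lambda>q. q powr r) has_derivative (*) (r * p powr (r - 1))) (at p)"
    by (simp add: has_field_derivative_def)
  then obtain d where d: "d > 0" "\<And>q. \<bar>q - p\<bar> < d \<Longrightarrow>
      \<bar>q powr r - p powr r - r * p powr (r - 1) * (q - p)\<bar> \<le> \<epsilon> * \<bar>q - p\<bar>"
    using \<epsilon> unfolding has_derivative_at_alt by (auto simp: real_norm_def)
  obtain C L where C: "C > 0" and L: "L > 0" and CL:
    "\<And>x n. real x \<ge> L \<Longrightarrow> x \<le> n \<Longrightarrow>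
      \<bar>(\<Prod>l\<in>{x<..n}. (real l - r) / (real l - 1)) - (real x / real n) powr (r - 1)\<bar>
      \<le> (real x / real n) powr (r - 1) * (C / real x)"
    using prod_shifted_ratio_asymp by blast
  have n1: "\<forall>\<^sub>F n in sequentially. C / (real n * p / 2) \<le> \<epsilon> * (1 / sqrt (real n))"
    using C p \<epsilon> by real_asymp
  have n2: "\<forall>\<^sub>F n in sequentially. L \<le> real n * p / 2"
    using p by real_asymp
  have n3: "\<forall>\<^sub>F n in sequentially. n > (0::nat)"
    by (rule eventually_gt_at_top)
  \<comment> \<open>A radius below \<open>d\<close> gives the derivative estimate; one below p / 2
    forces x > n p / 2, so x exceeds \<open>L\<close> and C / x is small once n is large.\<close>
  have main: "\<forall>\<^sub>F n in sequentially. \<forall>x\<le>n. \<bar>real x / real n - p\<bar> \<le> \<eta> \<longrightarrow>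
    \<bar>turing_term r n x - p powr r - r * p powr (r - 1) * (real x / real n - p)\<bar>
      \<le> \<epsilon> * (\<bar>real x / real n - p\<bar> + 1 / sqrt (real n))"
    if \<eta>: "\<eta> < d" "\<eta> < p / 2" for \<eta>
    using n1 n2 n3
  proof eventually_elim
    case (elim n)
    show ?case
    proof (intro allI impI)
      fix x assume x: "x \<le> n" and close: "\<bar>real x / real n - p\<bar> \<le> \<eta>"
      define q where "q = real x / real n"
      have q: "q > p / 2" "q \<le> 1" and qd: "\<bar>q - p\<bar> < d"
        using close \<eta> x elim by (auto simp: q_def)
      have xq: "real x = real n * q" using elim by (simp add: q_def)
      have xL: "real n * p / 2 \<le> real x" using q elim by (simp add: xq)
      have pos: "real n * p / 2 > 0" using elim p by simp
      have qpow: "q * q powr (r - 1) = q powr r"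
        using q p by (simp add: powr_diff)
      have "\<bar>turing_term r n x - q powr r\<bar>
          = q * \<bar>(\<Prod>l\<in>{x<..n}. (real l - r) / (real l - 1)) - q powr (r - 1)\<bar>"
        using q p unfolding turing_term_def q_def[symmetric] qpow[symmetric]
        by (simp add: abs_mult flip: right_diff_distrib)
      also have "\<dots> \<le> q * (q powr (r - 1) * (C / real x))"
        using CL[of x n] x xL elim q p by (intro mult_left_mono) (auto simp: q_def)
      also have "\<dots> = q powr r * (C / real x)"
        by (simp flip: qpow)
      also have "\<dots> \<le> 1 * (C / real x)"
        using q p r C by (intro mult_right_mono powr_le1) auto
      also have "\<dots> \<le> C / (real n * p / 2)"
        unfolding mult_1 using xL pos C by (intro divide_left_mono mult_pos_pos) linarith+
      also have "\<dots> \<le> \<epsilon> * (1 / sqrt (real n))" using elim by simp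
      finally have "\<bar>turing_term r n x - q powr r\<bar> \<le> \<epsilon> * (1 / sqrt (real n))" .
      with d(2)[OF qd]
      show "\<bar>turing_term r n x - p powr r - r * p powr (r - 1) * (real x / real n - p)\<bar>
          \<le> \<epsilon> * (\<bar>real x / real n - p\<bar> + 1 / sqrt (real n))"
        unfolding q_def[symmetric] distrib_left by linarith
    qed
  qed
  show ?thesis
    unfolding eventually_at_right[OF zero_less_one]
    using main d(1) p by (intro exI[of _ "min d (p / 2)"]) auto
qed

text \<open>The expansions of the single letters are added up and composed with \<open>ln\<close>,
  whose derivative at \<open>h\<close> is 1 / h. The factor \<open>h\<close> cancels this derivative
  and matches the normalisation of the limit theorem.\<close>

lemma ln_h_sharp_expansion:
  fixes r \<epsilon> :: real and p :: "nat \<Rightarrow> real"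
  assumes p: "\<And>k. k \<in> {1..K} \<Longrightarrow> p k > 0" and K: "K \<ge> 1" and r: "r > 0" and \<epsilon>: "\<epsilon> > 0"
  defines "h \<equiv> renyi_equiv_entropy K r p"
  shows "\<forall>\<^sub>F \<eta> in at_right 0. \<forall>\<^sub>F n in sequentially. \<forall>x. (\<Sum>k=1..K. x k) = n \<longrightarrow>
    (\<forall>k\<in>{1..K}. \<bar>real (x k) / real n - p k\<bar> \<le> \<eta>) \<longrightarrow>
    h_sharp K r n x > 0 \<and>
    \<bar>h * (ln (h_sharp K r n x) - ln h)
        - (\<Sum>k=1..K. r * p k powr (r - 1) * (real (x k) / real n - p k))\<bar>
      \<le> \<epsilon> * ((\<Sum>k=1..K. \<bar>real (x k) / real n - p k\<bar>) + 1 / sqrt (real n))"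
proof -
  define F where "F = (\<Sum>k=1..K. \<bar>r * p k powr (r - 1)\<bar>)"
  have F: "F \<ge> 0" by (simp add: F_def sum_nonneg)
  have h: "h > 0"
    unfolding h_def renyi_equiv_entropy_def using p K by (intro sum_pos) (auto simp: less_imp_neq[symmetric])
  \<comment> \<open>The bound 1 yields \<open>\<bar>z - h - D\<bar> \<le> B\<close>, hence
    \<open>\<bar>z - h\<bar> \<le> (F + 1) * B\<close>; the bound \<open>\<epsilon> / 2\<close> is
    half of the error allowance. The other half goes to \<open>\<epsilon>2\<close>, for the
    logarithm.\<close>
  define \<epsilon>1 where "\<epsilon>1 = min 1 (\<epsilon> / 2) / real K"
  have \<epsilon>1: "\<epsilon>1 > 0" "\<epsilon>1 * real K \<le> 1" "\<epsilon>1 * real K \<le> \<epsilon> / 2"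
    using \<epsilon> K by (auto simp: \<epsilon>1_def)
  define \<epsilon>2 where "\<epsilon>2 = \<epsilon> / (2 * h * (F + 1))"
  have \<epsilon>2: "\<epsilon>2 > 0" "h * (\<epsilon>2 * (F + 1)) = \<epsilon> / 2"
    using \<epsilon> h F by (auto simp: \<epsilon>2_def)
  have "(ln has_derivative (*) (inverse h)) (at h)"
    using DERIV_ln[OF h] by (simp add: has_field_derivative_def)
  then obtain d0 where d0: "d0 > 0" "\<And>z. \<bar>z - h\<bar> < d0 \<Longrightarrow>
      \<bar>ln z - ln h - inverse h * (z - h)\<bar> \<le> \<epsilon>2 * \<bar>z - h\<bar>"
    using \<epsilon>2(1) unfolding has_derivative_at_alt by (auto simp: real_norm_def)
  \<comment> \<open>Staying within \<open>h\<close> of \<open>h\<close> makes the estimator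
    positive; staying within \<open>d0\<close> gives the derivative estimate for
    \<open>ln\<close>.\<close>
  define d where "d = min d0 h"
  have d: "d > 0" using d0 h by (simp add: d_def)
  \<comment> \<open>Since \<open>A \<le> real K * \<eta>\<close>, this gives
    \<open>(F + 1) * A \<le> d / 2\<close>; the term 1 / sqrt n uses the other half of
    \<open>d\<close>.\<close>
  have "\<forall>\<^sub>F \<eta> in at_right 0. \<eta> \<le> d / (2 * (F + 1) * real K)"
    using d F K unfolding eventually_at_right[OF zero_less_one]
    by (intro exI[of _ "d / (2 * (F + 1) * real K)"]) auto
  moreover have "\<forall>\<^sub>F \<eta> in at_right 0. \<forall>k\<in>{1..K}. \<forall>\<^sub>F n in sequentially. \<forall>x\<le>n.
    \<bar>real x / real n - p k\<bar> \<le> \<eta> \<longrightarrow>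
    \<bar>turing_term r n x - p k powr r - r * p k powr (r - 1) * (real x / real n - p k)\<bar>
      \<le> \<epsilon>1 * (\<bar>real x / real n - p k\<bar> + 1 / sqrt (real n))"
    using p r \<epsilon>1 by (intro eventually_ball_finite ballI turing_term_expansion) auto
  ultimately show ?thesis
  proof eventually_elim
    case (elim \<eta>)
    have n1: "\<forall>\<^sub>F n in sequentially. \<forall>k\<in>{1..K}. \<forall>x\<le>n.
      \<bar>real x / real n - p k\<bar> \<le> \<eta> \<longrightarrow>
      \<bar>turing_term r n x - p k powr r - r * p k powr (r - 1) * (real x / real n - p k)\<bar>
        \<le> \<epsilon>1 * (\<bar>real x / real n - p k\<bar> + 1 / sqrt (real n))"
      using elim(2) by (intro eventually_ball_finite) auto
    have "F + 1 > 0" using F by simp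
    then have n2: "\<forall>\<^sub>F n in sequentially. (F + 1) * (1 / sqrt (real n)) < d / 2"
      using d by real_asymp
    show ?case
      using n1 n2 eventually_gt_at_top[of 0]
    proof eventually_elim
      case (elim n)
      note n = elim
      show ?case
      proof (intro allI impI)
        fix x assume x: "(\<Sum>k=1..K. x k) = n"
          and close: "\<forall>k\<in>{1..K}. \<bar>real (x k) / real n - p k\<bar> \<le> \<eta>"
        define \<delta> where "\<delta> k = real (x k) / real n - p k" for k
        define A where "A = (\<Sum>k=1..K. \<bar>\<delta> k\<bar>)"
        define B where "B = A + 1 / sqrt (real n)"
        define z where "z = h_sharp K r n x"
        define D where "D = (\<Sum>k=1..K. r * p k powr (r - 1) * \<delta> k)"
        have A: "A \<ge> 0" "A \<le> real K * \<eta>"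
          using close sum_bounded_above[of "{1..K}" "\<lambda>k. \<bar>\<delta> k\<bar>" \<eta>]
          by (auto simp: A_def \<delta>_def intro: sum_nonneg)
        have B: "B \<ge> A" "B \<ge> 1 / sqrt (real n)" "B \<ge> 0" using A by (auto simp: B_def)
        have xn: "x k \<le> n" if "k \<in> {1..K}" for k
          unfolding x[symmetric] using that by (intro member_le_sum) auto
        have "z - h - D = (\<Sum>k=1..K. turing_term r n (x k) - p k powr r
            - r * p k powr (r - 1) * \<delta> k)"
          by (simp add: z_def h_sharp_eq_sum_turing_term[OF n(3) x] h_def
              renyi_equiv_entropy_def D_def sum_subtractf)
        also have "\<bar>\<dots>\<bar> \<le> (\<Sum>k=1..K. \<epsilon>1 * (\<bar>\<delta> k\<bar> + 1 / sqrt (real n)))"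
          using n(1) close xn by (intro sum_abs[THEN order_trans] sum_mono) (auto simp: \<delta>_def)
        also have "\<dots> \<le> (\<Sum>k=1..K. \<epsilon>1 * B)"
        proof (intro sum_mono mult_left_mono)
          fix k assume "k \<in> {1..K}"
          then have "\<bar>\<delta> k\<bar> \<le> A" unfolding A_def by (intro member_le_sum) auto
          then show "\<bar>\<delta> k\<bar> + 1 / sqrt (real n) \<le> B" by (simp add: B_def)
        qed (use \<epsilon>1 in simp)
        finally have lin: "\<bar>z - h - D\<bar> \<le> \<epsilon>1 * real K * B" by (simp add: mult_ac)
        have "\<bar>D\<bar> \<le> (\<Sum>k=1..K. \<bar>r * p k powr (r - 1)\<bar> * A)"
          unfolding D_def
        proof (intro sum_abs[THEN order_trans] sum_mono)
          fix k assume "k \<in> {1..K}"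
          then have "\<bar>\<delta> k\<bar> \<le> A" unfolding A_def by (intro member_le_sum) auto
          then show "\<bar>r * p k powr (r - 1) * \<delta> k\<bar> \<le> \<bar>r * p k powr (r - 1)\<bar> * A"
            by (simp add: abs_mult mult_left_mono)
        qed
        also have "\<dots> = F * A" by (simp add: F_def sum_distrib_right)
        also have "\<dots> \<le> F * B" using F B by (intro mult_left_mono)
        finally have "\<bar>D\<bar> \<le> F * B" .
        moreover have "\<epsilon>1 * real K * B \<le> 1 * B"
          using \<epsilon>1 B by (intro mult_right_mono) auto
        ultimately have zh: "\<bar>z - h\<bar> \<le> (F + 1) * B"
          using lin unfolding distrib_right by linarith
        have "2 * (F + 1) * real K > 0" using F K by simp
        then have "\<eta> * (2 * (F + 1) * real K) \<le> d"
          using \<open>\<eta> \<le> d / (2 * (F + 1) * real K)\<close> by (simp only: pos_le_divide_eq)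
        moreover have "(F + 1) * A \<le> (F + 1) * (real K * \<eta>)"
          using A F by (intro mult_left_mono) auto
        moreover have "\<eta> * (2 * (F + 1) * real K) = 2 * ((F + 1) * (real K * \<eta>))" by simp
        ultimately have "(F + 1) * A \<le> d / 2" by linarith
        then have "(F + 1) * B < d" using n(2) unfolding B_def distrib_left by linarith
        then have zd: "\<bar>z - h\<bar> < d0" "\<bar>z - h\<bar> < h" using zh by (auto simp: d_def)
        have "h * (ln z - ln h) - (z - h) = h * (ln z - ln h - inverse h * (z - h))"
          using h by (simp add: right_diff_distrib)
        then have "\<bar>h * (ln z - ln h) - (z - h)\<bar> = h * \<bar>ln z - ln h - inverse h * (z - h)\<bar>"
          using h by (simp add: abs_mult)
        also have "\<dots> \<le> h * (\<epsilon>2 * ((F + 1) * B))"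
          using d0(2)[OF zd(1)] zh \<epsilon>2 h
          by (intro mult_left_mono) (auto intro: order_trans mult_left_mono)
        also have "\<dots> = \<epsilon> / 2 * B"
          by (subst \<epsilon>2(2)[symmetric]) (simp only: mult.assoc)
        finally have "\<bar>h * (ln z - ln h) - (z - h)\<bar> \<le> \<epsilon> / 2 * B" .
        moreover have "\<epsilon>1 * real K * B \<le> \<epsilon> / 2 * B"
          using \<epsilon>1 B by (intro mult_right_mono) auto
        ultimately have "\<bar>h * (ln z - ln h) - D\<bar> \<le> \<epsilon> * B"
          using lin by linarith
        moreover have "z > 0" using zd by linarith
        ultimately show "h_sharp K r n x > 0 \<and>
          \<bar>h * (ln (h_sharp K r n x) - ln h)
            - (\<Sum>k=1..K. r * p k powr (r - 1) * (real (x k) / real n - p k))\<bar>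
            \<le> \<epsilon> * ((\<Sum>k=1..K. \<bar>real (x k) / real n - p k\<bar>) + 1 / sqrt (real n))"
          by (simp add: z_def B_def A_def D_def \<delta>_def)
      qed
    qed
  qed
qed

section \<open>Independence and second moments\<close>

text \<open>Used to shift the sample so that it starts at index 0. An injective f carries a finite
  index set to a finite index set without merging factors, so the product formula for the image is
  the one wanted.\<close>

lemma (in prob_space) indep_vars_reindex:
  assumes "inj_on f I" and X: "indep_vars M' X (f ` I)"
  shows "indep_vars (\<lambda>i. M' (f i)) (\<lambda>i. X (f i)) I"
proof -
  define G where "G i = {X i -` A \<inter> space M |A. A \<in> sets (M' i)}" for i
  have rv: "\<And>i. i \<in> f ` I \<Longrightarrow> random_variable (M' i) (X i)" and G: "indep_sets G (f ` I)"
    using X unfolding indep_vars_def2 G_def by auto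
  have "indep_sets (\<lambda>i. G (f i)) I"
    unfolding indep_sets_def
  proof (intro conjI ballI allI impI)
    show "G (f i) \<subseteq> events" if "i \<in> I" for i
      using G that by (auto simp: indep_sets_def)
    fix J A assume J: "J \<subseteq> I" "J \<noteq> {}" "finite J" and A: "A \<in> (\<Pi> i\<in>J. G (f i))"
    have inj: "inj_on f J" using assms(1) J(1) by (rule inj_on_subset)
    let ?A = "\<lambda>i. A (the_inv_into J f i)"
    have A_eq: "?A (f j) = A j" if "j \<in> J" for j
      using inj that by (simp add: the_inv_into_f_f)
    have "f ` J \<subseteq> f ` I" "f ` J \<noteq> {}" "finite (f ` J)" "?A \<in> Pi (f ` J) G"
      using J A A_eq by auto
    then have "prob (\<Inter>j\<in>f ` J. ?A j) = (\<Prod>j\<in>f ` J. prob (?A j))"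
      using G unfolding indep_sets_def by blast
    then show "prob (\<Inter>j\<in>J. A j) = (\<Prod>j\<in>J. prob (A j))"
      using inj A_eq by (simp add: prod.reindex image_image)
  qed
  then show ?thesis
    using rv unfolding indep_vars_def2 G_def by auto
qed

text \<open>When the square is expanded, the mixed products have expectation 0 by independence and
  centring.\<close>

lemma (in prob_space) indep_vars_square_sum:
  fixes Z :: "nat \<Rightarrow> 'a \<Rightarrow> real"
  assumes indep: "indep_vars (\<lambda>_. borel) Z UNIV"
    and sq: "\<And>i. integrable M (\<lambda>\<omega>. (Z i \<omega>)\<^sup>2)"
    and mean: "\<And>i. expectation (Z i) = 0"
    and var: "\<And>i. expectation (\<lambda>\<omega>. (Z i \<omega>)\<^sup>2) = s"
  shows "integrable M (\<lambda>\<omega>. (\<Sum>i<n. Z i \<omega>)\<^sup>2)"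
    and "expectation (\<lambda>\<omega>. (\<Sum>i<n. Z i \<omega>)\<^sup>2) = real n * s"
proof -
  have meas [measurable]: "Z i \<in> borel_measurable M" for i
    using indep by (auto simp: indep_vars_def)
  have int: "integrable M (Z i)" for i
    using square_integrable_imp_integrable[OF meas sq] .
  \<comment> \<open>As a product over a two-element index set, the mixed term falls under the
    product formula for finite independent families.\<close>
  have prod2: "(\<lambda>\<omega>. Z i \<omega> * Z j \<omega>) = (\<lambda>\<omega>. \<Prod>l\<in>{i, j}. Z l \<omega>)" if "i \<noteq> j" for i j
    using that by auto
  have ind2: "indep_vars (\<lambda>_. borel) Z {i, j}" for i j
    using indep by (rule indep_vars_subset) simp
  have cross: "integrable M (\<lambda>\<omega>. Z i \<omega> * Z j \<omega>)" "expectation (\<lambda>\<omega>. Z i \<omega> * Z j \<omega>) = 0"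
    if "i \<noteq> j" for i j
    unfolding prod2[OF that]
    using int that mean ind2
    by (auto intro!: indep_vars_integrable simp: indep_vars_lebesgue_integral simp del: prod.insert)
  have *: "integrable M (\<lambda>\<omega>. (\<Sum>i<n. Z i \<omega>)\<^sup>2) \<and>
      expectation (\<lambda>\<omega>. (\<Sum>i<n. Z i \<omega>)\<^sup>2) = real n * s"
  proof (induction n)
    case (Suc n)
    have eq: "(\<lambda>\<omega>. (\<Sum>i<Suc n. Z i \<omega>)\<^sup>2)
        = (\<lambda>\<omega>. (\<Sum>i<n. Z i \<omega>)\<^sup>2 + (Z n \<omega>)\<^sup>2 + 2 * (\<Sum>i<n. Z i \<omega> * Z n \<omega>))"
      by (simp add: power2_sum sum_distrib_right mult_ac fun_eq_iff sum_distrib_left)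
    show ?case
    proof -
      have c: "integrable M (\<lambda>\<omega>. \<Sum>i<n. Z i \<omega> * Z n \<omega>)"
        "expectation (\<lambda>\<omega>. \<Sum>i<n. Z i \<omega> * Z n \<omega>) = 0"
        using cross by (auto intro!: Bochner_Integration.integrable_sum
            simp: Bochner_Integration.integral_sum)
      show ?thesis
        unfolding eq using Suc sq c by (simp add: var distrib_right)
    qed
  qed simp
  then show "integrable M (\<lambda>\<omega>. (\<Sum>i<n. Z i \<omega>)\<^sup>2)"
    and "expectation (\<lambda>\<omega>. (\<Sum>i<n. Z i \<omega>)\<^sup>2) = real n * s" by auto
qed

text \<open>\<open>Z\<close> encodes a real function of the random letter, with value
  \<open>a k\<close> at \<open>ell k\<close>. By injectivity of \<open>ell\<close> at most one
  indicator is nonzero, so squaring acts on the coefficients alone.\<close>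

lemma (in prob_space) finite_law_moments:
  fixes Y :: "'a \<Rightarrow> 'b" and ell :: "'i \<Rightarrow> 'b" and a p :: "'i \<Rightarrow> real"
  assumes Y: "Y \<in> measurable M (count_space (ell ` A))" and A: "finite A" "inj_on ell A"
    and law: "\<And>k. k \<in> A \<Longrightarrow> prob {\<omega> \<in> space M. Y \<omega> = ell k} = p k"
  defines "Z \<equiv> \<lambda>\<omega>. \<Sum>k\<in>A. a k * of_bool (Y \<omega> = ell k)"
  shows "expectation Z = (\<Sum>k\<in>A. a k * p k)"
    and "integrable M (\<lambda>\<omega>. (Z \<omega>)\<^sup>2)"
    and "expectation (\<lambda>\<omega>. (Z \<omega>)\<^sup>2) = (\<Sum>k\<in>A. (a k)\<^sup>2 * p k)"
proof -
  have ind: "integrable M (\<lambda>\<omega>. of_bool (Y \<omega> = ell k) :: real)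
      \<and> expectation (\<lambda>\<omega>. of_bool (Y \<omega> = ell k)) = p k" if "k \<in> A" for k
  proof -
    let ?E = "{\<omega> \<in> space M. Y \<omega> = ell k}"
    have "Y -` {ell k} \<inter> space M \<in> events" by (rule measurable_sets[OF Y]) (use that in simp)
    also have "Y -` {ell k} \<inter> space M = ?E" by auto
    finally have E: "?E \<in> events" .
    have "integrable M (indicator ?E :: _ \<Rightarrow> real) \<and> expectation (indicat_real ?E) = p k"
      using E law[OF that] by (simp add: Int_absorb2 sets.sets_into_space emeasure_eq_measure)
    moreover have "integrable M (\<lambda>\<omega>. of_bool (Y \<omega> = ell k) :: real) = integrable M (indicator ?E :: _ \<Rightarrow> real)"
      by (rule Bochner_Integration.integrable_cong) (auto simp: indicator_def)
    moreover have "expectation (\<lambda>\<omega>. of_bool (Y \<omega> = ell k)) = expectation (indicat_real ?E)"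
      by (rule Bochner_Integration.integral_cong) (auto simp: indicator_def)
    ultimately show ?thesis by metis
  qed
  have Zsq: "(Z \<omega>)\<^sup>2 = (\<Sum>k\<in>A. (a k)\<^sup>2 * of_bool (Y \<omega> = ell k))" for \<omega>
  proof (cases "\<exists>k\<in>A. Y \<omega> = ell k")
    case True
    then obtain k where k: "k \<in> A" "Y \<omega> = ell k" by blast
    have "Y \<omega> = ell j \<longleftrightarrow> j = k" if "j \<in> A" for j
      using A(2) k that by (auto dest: inj_onD)
    then have "(\<Sum>j\<in>A. b j * of_bool (Y \<omega> = ell j)) = (\<Sum>j\<in>A. if j = k then b j else 0)"
      for b :: "'i \<Rightarrow> real"
      by (intro sum.cong) auto
    then show ?thesis
      using k A(1) by (simp add: Z_def)
  qed (auto simp: Z_def intro!: sum.neutral)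
  show "expectation Z = (\<Sum>k\<in>A. a k * p k)"
    unfolding Z_def using ind by (subst Bochner_Integration.integral_sum) auto
  show "integrable M (\<lambda>\<omega>. (Z \<omega>)\<^sup>2)"
    unfolding Zsq using ind by (intro Bochner_Integration.integrable_sum) auto
  show "expectation (\<lambda>\<omega>. (Z \<omega>)\<^sup>2) = (\<Sum>k\<in>A. (a k)\<^sup>2 * p k)"
    unfolding Zsq using ind by (subst Bochner_Integration.integral_sum) auto
qed

section \<open>The limiting variance\<close>

text \<open>The matrix is the covariance matrix of the indicators of the first K - 1 letters, so the
  form is the variance of f - f(K), which vanishes at the last letter. A variance does not change
  under the shift by f(K).\<close>

lemma Sigma_mat_quadratic_form:
  fixes p f g :: "nat \<Rightarrow> real"
  assumes K: "K \<ge> 1" and sum1: "(\<Sum>k=1..K. p k) = 1"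
    and g: "\<And>k. k \<in> {1..K-1} \<Longrightarrow> g k = f k - f K"
  shows "(\<Sum>i=1..K-1. \<Sum>j=1..K-1. g i * Sigma_mat p i j * g j)
    = (\<Sum>k=1..K. (f k)\<^sup>2 * p k) - (\<Sum>k=1..K. f k * p k)\<^sup>2"
proof -
  define d where "d k = f k - f K" for k
  have gd: "g k = d k" if "k \<in> {1..K-1}" for k using g[OF that] by (simp add: d_def)
  have insK: "{1..K} = insert K {1..K-1}" using K by auto
  have ext: "(\<Sum>k=1..K-1. u k) = (\<Sum>k=1..K. u k)" if "u K = 0" for u :: "nat \<Rightarrow> real"
    unfolding insK using that K by simp
  have row: "(\<Sum>j=1..K-1. g i * Sigma_mat p i j * g j)
      = (d i)\<^sup>2 * p i - d i * p i * (\<Sum>j=1..K. d j * p j)" if i: "i \<in> {1..K-1}" for i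
  proof -
    have "(\<Sum>j=1..K-1. g i * Sigma_mat p i j * g j)
        = (\<Sum>j=1..K-1. (if i = j then (d i)\<^sup>2 * p i else 0) - d i * p i * (d j * p j))"
      using i gd by (intro sum.cong) (auto simp: Sigma_mat_def power2_eq_square algebra_simps)
    also have "\<dots> = (d i)\<^sup>2 * p i - d i * p i * (\<Sum>j=1..K-1. d j * p j)"
      using i by (simp add: sum_subtractf sum_distrib_left)
    also have "(\<Sum>j=1..K-1. d j * p j) = (\<Sum>j=1..K. d j * p j)"
      by (rule ext) (simp add: d_def)
    finally show ?thesis .
  qed
  have "(\<Sum>i=1..K-1. \<Sum>j=1..K-1. g i * Sigma_mat p i j * g j)
      = (\<Sum>i=1..K. (d i)\<^sup>2 * p i - d i * p i * (\<Sum>j=1..K. d j * p j))"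
    by (subst ext[symmetric]) (use row in \<open>simp_all add: d_def\<close>)
  also have "\<dots> = (\<Sum>i=1..K. (d i)\<^sup>2 * p i) - (\<Sum>j=1..K. d j * p j)\<^sup>2"
    by (simp add: sum_subtractf power2_eq_square sum_distrib_right)
  also have "(\<Sum>j=1..K. d j * p j) = (\<Sum>k=1..K. f k * p k) - f K"
    using sum1 by (simp add: d_def left_diff_distrib sum_subtractf flip: sum_distrib_left)
  also have "(\<Sum>i=1..K. (d i)\<^sup>2 * p i)
      = (\<Sum>i=1..K. (f i)\<^sup>2 * p i - 2 * f K * (f i * p i) + (f K)\<^sup>2 * p i)"
    by (simp add: d_def power2_diff algebra_simps)
  also have "\<dots> = (\<Sum>k=1..K. (f k)\<^sup>2 * p k) - 2 * f K * (\<Sum>k=1..K. f k * p k) + (f K)\<^sup>2"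
    using sum1 by (simp add: sum.distrib sum_subtractf flip: sum_distrib_left)
  finally show ?thesis by (simp add: power2_diff algebra_simps)
qed

text \<open>The difference is the weighted sum of (f k - m)^2 with m the mean, and some term is
  positive.\<close>

lemma weighted_variance_pos:
  fixes p f :: "'i \<Rightarrow> real"
  assumes A: "finite A" and p: "\<And>k. k \<in> A \<Longrightarrow> p k > 0" and sum1: "(\<Sum>k\<in>A. p k) = 1"
    and nonconst: "\<And>m. \<exists>k\<in>A. f k \<noteq> m"
  shows "(\<Sum>k\<in>A. (f k)\<^sup>2 * p k) - (\<Sum>k\<in>A. f k * p k)\<^sup>2 > 0"
proof -
  define m where "m = (\<Sum>k\<in>A. f k * p k)"
  obtain j where j: "j \<in> A" "f j \<noteq> m" using nonconst by blast
  have "0 < (f j - m)\<^sup>2 * p j" using j p by simp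
  also have "\<dots> \<le> (\<Sum>k\<in>A. (f k - m)\<^sup>2 * p k)"
    using A j p by (intro member_le_sum) (auto simp: less_imp_le)
  also have "\<dots> = (\<Sum>k\<in>A. (f k)\<^sup>2 * p k - 2 * m * (f k * p k) + m\<^sup>2 * p k)"
    by (simp add: power2_diff algebra_simps)
  also have "\<dots> = (\<Sum>k\<in>A. (f k)\<^sup>2 * p k) - m\<^sup>2"
    by (simp add: sum.distrib sum_subtractf sum1 flip: sum_distrib_left m_def)
      (simp add: power2_eq_square)
  finally show ?thesis by (simp add: m_def)
qed

section \<open>Asymptotic normality: central limit theorem plus a negligible remainder\<close>

theorem theorem3:
  fixes K :: nat and r :: real and p :: "nat \<Rightarrow> real"
    and ell :: "nat \<Rightarrow> 'a"
    and M :: "'w measure" and X :: "nat \<Rightarrow> 'w \<Rightarrow> 'a"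
    and c :: "nat \<Rightarrow> 'w \<Rightarrow> real"
  assumes p_pos: "\<And>k. k \<in> {1..K} \<Longrightarrow> p k > 0"
    and p_sum: "(\<Sum>k=1..K. p k) = 1"
    and letters: "inj_on ell {1..K}"
    and M: "prob_space M"
    and indep: "prob_space.indep_vars M (\<lambda>_. count_space (ell ` {1..K})) X {1..}"
    and ident: "\<And>i. i \<ge> 1 \<Longrightarrow>
          distr M (count_space (ell ` {1..K})) (X i) = distr M (count_space (ell ` {1..K})) (X 1)"
    and law: "\<And>k. k \<in> {1..K} \<Longrightarrow> measure M {\<omega> \<in> space M. X 1 \<omega> = ell k} = p k"
    and c_meas: "\<And>n. c n \<in> borel_measurable M"
    and r: "r > 0" "r \<noteq> 1"
    and nonuniform: "\<exists>k\<in>{1..K}. p k \<noteq> 1 / real K"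
  shows "weak_conv_m
    (\<lambda>n. distr M borel (\<lambda>\<omega>.
        sqrt (real n)
        * (H_sharp K r n (\<lambda>k. letter_count X n (ell k) \<omega>) (c n \<omega>) - renyi_entropy K r p)
        * renyi_equiv_entropy K r p * (1 - r)
        * (\<Sum>i=1..K-1. \<Sum>j=1..K-1. g_grad K r p i * Sigma_mat p i j * g_grad K r p j) powr (- 1 / 2)))
    std_normal_distribution"
proof -
  interpret prob_space M by (rule M)
  let ?L = "count_space (ell ` {1..K})"
  \<comment> \<open>The sample starts at index 1, while the central limit theorem counts from
    0.\<close>
  define Y where "Y i = X (Suc i)" for i
  have Suc_image: "range Suc = {1..}"
    by (auto simp: image_iff Suc_le_eq gr0_conv_Suc)
  have indepY: "indep_vars (\<lambda>_. ?L) Y UNIV"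
    unfolding Y_def
    by (rule indep_vars_reindex[of Suc UNIV "\<lambda>_. ?L" X])
      (use indep in \<open>simp_all add: Suc_image\<close>)
  then have Y [measurable]: "Y i \<in> measurable M ?L" for i
    by (auto simp: indep_vars_def)
  have Yset: "Y i \<omega> \<in> ell ` {1..K}" if "\<omega> \<in> space M" for i \<omega>
    using measurable_space[OF Y that] by simp
  have distrY: "distr M ?L (Y i) = distr M ?L (Y 0)" for i
    using ident[of "Suc i"] by (simp add: Y_def)
  have lawY: "prob {\<omega> \<in> space M. Y i \<omega> = ell k} = p k" if k: "k \<in> {1..K}" for i k
  proof -
    have "prob {\<omega> \<in> space M. Y i \<omega> = ell k} = measure (distr M ?L (Y i)) {ell k}" for i
      using k by (subst measure_distr[OF Y]) (auto intro!: arg_cong[where f = prob])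
    then show ?thesis
      using law[OF k] distrY[of i] by (simp add: Y_def)
  qed
  have K: "K \<ge> 1" using nonuniform by auto
  define Z where "Z a i \<omega> = (\<Sum>k\<in>{1..K}. a k * of_bool (Y i \<omega> = ell k))"
    for a :: "nat \<Rightarrow> real" and i \<omega>
  note Z_moments = finite_law_moments[OF Y finite_atLeastAtMost letters lawY, folded Z_def]
  have Z_comp: "Z a i = (\<lambda>\<omega>. (\<lambda>y. \<Sum>k\<in>{1..K}. a k * of_bool (y = ell k)) (Y i \<omega>))" for a i
    by (simp add: Z_def fun_eq_iff)
  have indepZ: "indep_vars (\<lambda>_. borel) (\<lambda>i \<omega>. Z a i \<omega> - m) UNIV" for a m
    unfolding Z_def
    by (rule indep_vars_compose2[OF indepY,
          where Y = "\<lambda>i y. (\<Sum>k\<in>{1..K}. a k * of_bool (y = ell k)) - m"]) simp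
  have Z_meas [measurable]: "Z a i \<in> borel_measurable M" for a i
    unfolding Z_comp by (rule measurable_compose[OF Y]) simp
  have Z_distr: "distr M borel (Z a i) = distr M borel (Z a 0)" for a i
  proof -
    let ?z = "\<lambda>y. \<Sum>k\<in>{1..K}. a k * of_bool (y = ell k) :: real"
    have "distr M borel (Z a i) = distr (distr M ?L (Y i)) borel ?z" for i
      by (subst distr_distr[OF _ Y]) (simp_all add: Z_comp comp_def)
    then show ?thesis by (simp only: distrY[of i])
  qed

  define N where "N n \<omega> k = letter_count X n (ell k) \<omega>" for n \<omega> k
  have N_eq: "N n \<omega> k = (\<Sum>i<n. of_bool (Y i \<omega> = ell k))" for n \<omega> k
    unfolding N_def letter_count_def Y_def by (rule sum.reindex_bij_witness[of _ Suc "\<lambda>i. i - 1"]) auto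
  have N_sum: "(\<Sum>k=1..K. N n \<omega> k) = n" if \<omega>: "\<omega> \<in> space M" for n \<omega>
  proof -
    have one: "(\<Sum>k=1..K. of_bool (Y i \<omega> = ell k)) = (1::nat)" for i
    proof -
      obtain j where j: "j \<in> {1..K}" "Y i \<omega> = ell j" using Yset[OF \<omega>, of i] by blast
      have "(\<Sum>k=1..K. of_bool (Y i \<omega> = ell k)) = (\<Sum>k=1..K. if k = j then 1 else (0::nat))"
        using j letters by (intro sum.cong) (auto dest: inj_onD)
      then show ?thesis using j(1) by simp
    qed
    show ?thesis unfolding N_eq by (subst sum.swap) (simp only: one sum_constant card_lessThan mult_1_right of_nat_id)
  qed
  \<comment> \<open>Linear combinations of the counts become sums of i.i.d. variables.\<close>
  have NZ: "(\<Sum>k=1..K. a k * real (N n \<omega> k)) = (\<Sum>i<n. Z a i \<omega>)" for a n \<omega>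
    unfolding N_eq Z_def by (subst sum.swap) (simp add: sum_distrib_left del: sum_of_bool_eq)
  have N_meas [measurable]: "(\<lambda>\<omega>. N n \<omega> k) \<in> measurable M (count_space UNIV)"
    if k: "k \<in> {1..K}" for n k
  proof -
    have "(\<lambda>\<omega>. of_bool (Y i \<omega> = ell k) :: nat) \<in> measurable M (count_space UNIV)" for i
      by (rule measurable_compose[OF Y]) simp
    then show ?thesis unfolding N_eq by measurable
  qed

  define \<delta> where "\<delta> n \<omega> k = real (N n \<omega> k) / real n - p k" for n \<omega> k
  \<comment> \<open>\<open>\<delta>\<close> is the mean of n centred i.i.d. indicators, so its
    second moment is p_k (1 - p_k) / n.\<close>
  have \<delta>_sq: "integrable M (\<lambda>\<omega>. (\<delta> n \<omega> k)\<^sup>2) \<and> expectation (\<lambda>\<omega>. (\<delta> n \<omega> k)\<^sup>2) \<le> 1 / real n"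
    if k: "k \<in> {1..K}" and n: "n > 0" for n k
  proof -
    define a where "a j = (of_bool (j = k) :: real)" for j
    have ap: "(\<Sum>j\<in>{1..K}. a j * p j) = p k" "(\<Sum>j\<in>{1..K}. (a j)\<^sup>2 * p j) = p k"
      "(\<Sum>j=1..K. a j * real (N n \<omega> j)) = real (N n \<omega> k)" for \<omega>
      using k by (simp_all add: a_def of_bool_def if_distrib[of "\<lambda>t. t * _"] if_distrib[of "\<lambda>t. t ^ 2"]
          cong: if_cong)
    have int: "integrable M (Z a i)" for i
      by (rule square_integrable_imp_integrable[OF Z_meas Z_moments(2)])
    have E: "expectation (Z a i) = p k" "expectation (\<lambda>\<omega>. (Z a i \<omega>)\<^sup>2) = p k" for i
      using Z_moments(1)[of a i] Z_moments(3)[of a i] by (simp_all only: ap)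
    have c: "integrable M (\<lambda>\<omega>. (Z a i \<omega> - p k)\<^sup>2)" "expectation (\<lambda>\<omega>. Z a i \<omega> - p k) = 0"
      "expectation (\<lambda>\<omega>. (Z a i \<omega> - p k)\<^sup>2) = p k - (p k)\<^sup>2" for i
      using int[of i] Z_moments(2)[of a i] variance_eq[OF int[of i] Z_moments(2)]
      by (simp_all add: E prob_space power2_diff)
    note sq = indep_vars_square_sum[OF indepZ c]
    have \<delta>_eq: "\<delta> n \<omega> k = (\<Sum>i<n. Z a i \<omega> - p k) / real n" for \<omega>
      using n unfolding sum_subtractf NZ[symmetric] ap(3) by (simp add: \<delta>_def diff_divide_distrib)
    have "p k \<le> 1" using p_pos k unfolding p_sum[symmetric] by (intro member_le_sum) (auto simp: less_imp_le)
    have "p k - (p k)\<^sup>2 \<le> 1" using \<open>p k \<le> 1\<close> zero_le_power2[of "p k"] by linarith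
    then have "real n * (p k - (p k)\<^sup>2) / (real n)\<^sup>2 \<le> 1 / real n"
      using n by (simp add: power2_eq_square divide_right_mono)
    then show ?thesis
      using sq[of n] by (simp add: \<delta>_eq power_divide)
  qed

  define f where "f k = r * p k powr (r - 1)" for k
  define \<mu> where "\<mu> = (\<Sum>k=1..K. f k * p k)"
  define V where "V = (\<Sum>k=1..K. (f k)\<^sup>2 * p k) - \<mu>\<^sup>2"
  define h where "h = renyi_equiv_entropy K r p"
  have V_eq: "(\<Sum>i=1..K-1. \<Sum>j=1..K-1. g_grad K r p i * Sigma_mat p i j * g_grad K r p j) = V"
    unfolding V_def \<mu>_def
    by (rule Sigma_mat_quadratic_form[OF K p_sum]) (unfold f_def, rule g_grad_eq[OF p_sum p_pos])
  \<comment> \<open>As r is neither 0 nor 1, t \<mapsto> r t^(r-1) is injective for t > 0; a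
    constant \<open>f\<close> would make \<open>p\<close> uniform.\<close>
  have "\<exists>k\<in>{1..K}. f k \<noteq> m" for m
  proof (rule ccontr)
    assume "\<not> ?thesis"
    then have "f k = f 1" if "k \<in> {1..K}" for k using that K by auto
    then have eq: "p k = p 1" if k: "k \<in> {1..K}" for k
    proof -
      have "p k > 0" "p 1 > 0" using p_pos k K by auto
      moreover have "ln (p k powr (r - 1)) = ln (p 1 powr (r - 1))"
        using \<open>\<And>k. k \<in> {1..K} \<Longrightarrow> f k = f 1\<close>[OF k] r by (simp add: f_def)
      ultimately show ?thesis using r by (simp add: ln_powr)
    qed
    have "1 = (\<Sum>k=1..K. p 1)" unfolding p_sum[symmetric] by (rule sum.cong[OF refl eq])
    then have "p 1 = 1 / real K" using K by (simp add: field_simps)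
    then show False using nonuniform eq by auto
  qed
  then have V: "V > 0"
    unfolding V_def \<mu>_def using p_pos p_sum by (intro weighted_variance_pos) auto
  have h: "h > 0"
    unfolding h_def renyi_equiv_entropy_def using p_pos K
    by (intro sum_pos) (auto simp: less_imp_neq[symmetric])

  \<comment> \<open>\<open>S\<close> is the normalised linear part, to which the central limit
    theorem applies; \<open>T\<close> is the statistic of the theorem.\<close>
  define S where "S n \<omega> = (\<Sum>i<n. Z f i \<omega> - \<mu>) / sqrt (real n * (sqrt V)\<^sup>2)" for n \<omega>
  define T where "T n \<omega> = sqrt (real n)
      * (H_sharp K r n (N n \<omega>) (c n \<omega>) - renyi_entropy K r p) * h * (1 - r) * V powr (- 1 / 2)" for n \<omega>
  have clt: "weak_conv_m (\<lambda>n. distr M borel (S n)) std_normal_distribution"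
    unfolding S_def
  proof (rule central_limit_theorem)
    show "indep_vars (\<lambda>_. borel) (Z f) UNIV" using indepZ[of f 0] by simp
    show "expectation (Z f i) = \<mu>" for i
      using Z_moments(1)[of f i] by (simp only: \<mu>_def)
    show "integrable M (\<lambda>\<omega>. (Z f i \<omega>)\<^sup>2)" for i by (rule Z_moments(2))
    show "variance (Z f i) = (sqrt V)\<^sup>2" for i
      using V variance_eq[OF square_integrable_imp_integrable[OF Z_meas Z_moments(2)] Z_moments(2), of f i]
        Z_moments(1)[of f i] Z_moments(3)[of f i]
      by (simp add: V_def \<mu>_def)
    show "distr M borel (Z f i) = distr M borel (Z f 0)" for i by (rule Z_distr)
    show "sqrt V > 0" using V by simp
  qed
  have S_eq: "S n \<omega> = sqrt (real n) * (\<Sum>k=1..K. f k * \<delta> n \<omega> k) / sqrt V" if n: "n > 0" for n \<omega>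
  proof -
    have "(\<Sum>k=1..K. f k * \<delta> n \<omega> k) = (\<Sum>i<n. Z f i \<omega> - \<mu>) / real n"
      using n NZ[of f n \<omega>] by (simp add: \<delta>_def right_diff_distrib sum_subtractf \<mu>_def diff_divide_distrib
          flip: sum_divide_distrib)
    then have "(\<Sum>i<n. Z f i \<omega> - \<mu>) = sqrt (real n) * sqrt (real n) * (\<Sum>k=1..K. f k * \<delta> n \<omega> k)"
      using n by simp
    then show ?thesis
      using n V by (simp add: S_def real_sqrt_mult del: real_sqrt_mult_self)
  qed

  have h_sharp_meas: "(\<lambda>\<omega>. h_sharp K r n (N n \<omega>)) \<in> borel_measurable M" for n
    unfolding h_sharp_def
  proof (intro borel_measurable_add borel_measurable_sum borel_measurable_const)
    fix k assume k: "k \<in> {1..K}"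
    \<comment> \<open>The summation range depends on \<open>\<omega>\<close>, so the summand is
      treated as a function on the discrete space of counts.\<close>
    show "(\<lambda>\<omega>. real (N n \<omega> k) / real n * (\<Sum>v=1..n - N n \<omega> k. w_coeff r v *
        (\<Prod>j=1..v. 1 - (real (N n \<omega> k) - 1) / (real n - real j)))) \<in> borel_measurable M"
      by (rule measurable_compose[OF N_meas[OF k],
            where g = "\<lambda>x. real x / real n * (\<Sum>v=1..n - x. w_coeff r v *
              (\<Prod>j=1..v. 1 - (real x - 1) / (real n - real j)))"]) simp
  qed
  have T_meas: "T n \<in> borel_measurable M" for n
    unfolding T_def H_sharp_def using h_sharp_meas[of n] c_meas[of n] by measurable
  have S_meas: "S n \<in> borel_measurable M" for n
    unfolding S_def by measurable

  have "(\<lambda>n. expectation (\<lambda>\<omega>. min 1 \<bar>T n \<omega> - S n \<omega>\<bar>)) \<longlonglongrightarrow> 0"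
  proof (rule tendstoI)
    fix e :: real assume e: "e > 0"
    \<comment> \<open>The factor \<open>2 * real K + 1\<close> collects K from the constants in y
      \<le> 1 + y^2, another K from n times the expectation of \<open>Q\<close>, and 1 from the term
      1 / sqrt n. This part then contributes e / 2.\<close>
    define \<epsilon> where "\<epsilon> = e * sqrt V / (2 * (2 * real K + 1))"
    have \<epsilon>: "\<epsilon> > 0" using e V by (simp add: \<epsilon>_def)
    have \<epsilon>V: "\<epsilon> / sqrt V * (2 * real K + 1) = e / 2"
    proof -
      have "e * s / (2 * w) / s * w = e / 2" if "s > 0" "w > 0" for s w :: real
        using that by simp
      then show ?thesis unfolding \<epsilon>_def using V by (metis add_nonneg_pos of_nat_0_le_iff
            mult_nonneg_nonneg real_sqrt_gt_zero zero_le_numeral zero_less_one)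
    qed
    let ?P = "\<lambda>\<eta> n. \<forall>x. (\<Sum>k=1..K. x k) = n \<longrightarrow>
      (\<forall>k\<in>{1..K}. \<bar>real (x k) / real n - p k\<bar> \<le> \<eta>) \<longrightarrow>
      h_sharp K r n x > 0 \<and>
      \<bar>h * (ln (h_sharp K r n x) - ln h) - (\<Sum>k=1..K. f k * (real (x k) / real n - p k))\<bar>
        \<le> \<epsilon> * ((\<Sum>k=1..K. \<bar>real (x k) / real n - p k\<bar>) + 1 / sqrt (real n))"
    have "\<forall>\<^sub>F \<eta> in at_right 0. \<forall>\<^sub>F n in sequentially. ?P \<eta> n"
      unfolding h_def f_def by (rule ln_h_sharp_expansion[OF _ K r(1) \<epsilon>]) (rule p_pos)
    from eventually_happens[OF eventually_conj[OF eventually_at_right_less this]]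
    obtain \<eta> where \<eta>: "\<eta> > 0" and exp: "\<forall>\<^sub>F n in sequentially. ?P \<eta> n"
      by auto
    have small: "\<forall>\<^sub>F n in sequentially. real K * (1 / real n) / \<eta>\<^sup>2 < e / 2"
      using e \<eta> by real_asymp
    show "\<forall>\<^sub>F n in sequentially. dist (expectation (\<lambda>\<omega>. min 1 \<bar>T n \<omega> - S n \<omega>\<bar>)) 0 < e"
      using exp small eventually_gt_at_top[of 0]
    proof eventually_elim
      case (elim n)
      define Q where "Q \<omega> = (\<Sum>k=1..K. (\<delta> n \<omega> k)\<^sup>2)" for \<omega>
      have Q: "integrable M Q" "expectation Q \<le> real K * (1 / real n)"
      proof -
        show "integrable M Q" unfolding Q_def using \<delta>_sq elim(3) by auto
        have "expectation Q = (\<Sum>k=1..K. expectation (\<lambda>\<omega>. (\<delta> n \<omega> k)\<^sup>2))"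
          unfolding Q_def using \<delta>_sq elim(3) by (intro Bochner_Integration.integral_sum) auto
        also have "\<dots> \<le> (\<Sum>k=1..K. 1 / real n)" using \<delta>_sq elim(3) by (intro sum_mono) auto
        finally show "expectation Q \<le> real K * (1 / real n)" by simp
      qed
      \<comment> \<open>The first summand dominates the difference when all frequencies are within
        \<open>\<eta>\<close> of \<open>p\<close>, where the estimator is positive and the fallback
        value \<open>c\<close> does not enter. Otherwise \<open>Q \<omega> / \<eta>\<^sup>2\<close>
        is at least 1 and dominates the truncated difference whatever the value of \<open>T\<close>,
        as in Chebyshev's inequality.\<close>
      define U where "U \<omega> = \<epsilon> / sqrt V * (real K + 1 + real n * Q \<omega>) + Q \<omega> / \<eta>\<^sup>2" for \<omega>
      have bound: "min 1 \<bar>T n \<omega> - S n \<omega>\<bar> \<le> U \<omega>" if \<omega>: "\<omega> \<in> space M" for \<omega>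
      proof (cases "\<forall>k\<in>{1..K}. \<bar>\<delta> n \<omega> k\<bar> \<le> \<eta>")
        case True
        define z where "z = h_sharp K r n (N n \<omega>)"
        define D where "D = (\<Sum>k=1..K. f k * \<delta> n \<omega> k)"
        have z: "z > 0" and zD: "\<bar>h * (ln z - ln h) - D\<bar>
            \<le> \<epsilon> * ((\<Sum>k=1..K. \<bar>\<delta> n \<omega> k\<bar>) + 1 / sqrt (real n))"
          using elim(1)[rule_format, OF N_sum[OF \<omega>]] True by (auto simp: z_def D_def \<delta>_def)
        have "(H_sharp K r n (N n \<omega>) (c n \<omega>) - renyi_entropy K r p) * (1 - r) = ln z - ln h"
          using z r by (simp add: H_sharp_def z_def[symmetric] renyi_entropy_def h_def[symmetric]
              left_diff_distrib)
        moreover have "V powr (- 1 / 2) = 1 / sqrt V"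
          using V powr_minus_divide[of V "1 / 2"] by (simp add: powr_half_sqrt)
        moreover have "T n \<omega> = sqrt (real n) * (h * ((H_sharp K r n (N n \<omega>) (c n \<omega>)
            - renyi_entropy K r p) * (1 - r))) * V powr (- 1 / 2)"
          by (simp only: T_def mult_ac)
        ultimately have "T n \<omega> = sqrt (real n) * (h * (ln z - ln h)) / sqrt V" by simp
        then have "T n \<omega> - S n \<omega> = sqrt (real n) / sqrt V * (h * (ln z - ln h) - D)"
          using elim(3) by (simp add: S_eq D_def right_diff_distrib diff_divide_distrib)
        then have "\<bar>T n \<omega> - S n \<omega>\<bar> = sqrt (real n) / sqrt V * \<bar>h * (ln z - ln h) - D\<bar>"
          using V by (simp add: abs_mult)
        also have "\<dots> \<le> sqrt (real n) / sqrt V *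
            (\<epsilon> * ((\<Sum>k=1..K. \<bar>\<delta> n \<omega> k\<bar>) + 1 / sqrt (real n)))"
          using zD V by (intro mult_left_mono) auto
        also have "\<dots> = \<epsilon> / sqrt V * ((\<Sum>k=1..K. sqrt (real n) * \<bar>\<delta> n \<omega> k\<bar>) + 1)"
          using elim(3) by (simp add: distrib_left flip: sum_distrib_left)
        also have "\<dots> \<le> \<epsilon> / sqrt V * ((\<Sum>k=1..K. 1 + real n * (\<delta> n \<omega> k)\<^sup>2) + 1)"
        proof (intro mult_left_mono add_right_mono sum_mono)
          fix k
          \<comment> \<open>Passing to squares reduces the absolute deviations to the second moments
            already bounded.\<close>
          define y where "y = sqrt (real n) * \<bar>\<delta> n \<omega> k\<bar>"
          have "0 \<le> (y - 1 / 2)\<^sup>2" by simp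
          then have "y \<le> 1 + y\<^sup>2" by (simp add: power2_diff) (simp add: power2_eq_square)
          then show "sqrt (real n) * \<bar>\<delta> n \<omega> k\<bar> \<le> 1 + real n * (\<delta> n \<omega> k)\<^sup>2"
            by (simp add: y_def power_mult_distrib)
        qed (use \<epsilon> V in auto)
        also have "\<dots> = \<epsilon> / sqrt V * (real K + 1 + real n * Q \<omega>)"
          by (simp add: Q_def sum.distrib sum_distrib_left)
        also have "\<dots> \<le> U \<omega>" by (simp add: U_def Q_def sum_nonneg)
        finally show ?thesis by simp
      next
        case False
        then obtain k where k: "k \<in> {1..K}" "\<eta> < \<bar>\<delta> n \<omega> k\<bar>" by auto
        have "\<eta>\<^sup>2 \<le> (\<delta> n \<omega> k)\<^sup>2" using \<eta> k(2) by (metis abs_le_square_iff abs_of_pos less_imp_le)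
        also have "\<dots> \<le> Q \<omega>" unfolding Q_def using k(1) by (intro member_le_sum) auto
        finally have "1 \<le> Q \<omega> / \<eta>\<^sup>2" using \<eta> by simp
        moreover have "0 \<le> \<epsilon> / sqrt V * (real K + 1 + real n * Q \<omega>)"
          using \<epsilon> V by (intro mult_nonneg_nonneg) (auto simp: Q_def intro!: add_nonneg_nonneg mult_nonneg_nonneg sum_nonneg)
        ultimately show ?thesis by (simp add: U_def)
      qed
      have "expectation (\<lambda>\<omega>. min 1 \<bar>T n \<omega> - S n \<omega>\<bar>) \<le> expectation U"
      proof (rule integral_mono[OF _ _ bound])
        show "integrable M (\<lambda>\<omega>. min 1 \<bar>T n \<omega> - S n \<omega>\<bar>)"
          using T_meas[of n] S_meas[of n] by (intro integrable_const_bound[where B = 1]) auto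
        show "integrable M U" unfolding U_def using Q by auto
      qed
      also have "expectation U
          = \<epsilon> / sqrt V * (real K + 1 + real n * expectation Q) + expectation Q / \<eta>\<^sup>2"
        unfolding U_def using Q(1) by (simp add: prob_space)
      also have "\<dots> \<le> \<epsilon> / sqrt V * (real K + 1 + real n * (real K * (1 / real n)))
          + real K * (1 / real n) / \<eta>\<^sup>2"
        using Q(2) \<epsilon> V by (intro add_mono mult_left_mono divide_right_mono order_refl) auto
      also have "\<dots> = e / 2 + real K * (1 / real n) / \<eta>\<^sup>2"
        using elim(3) \<epsilon>V by (simp add: algebra_simps)
      also have "\<dots> < e" using elim(2) by linarith
      finally have "expectation (\<lambda>\<omega>. min 1 \<bar>T n \<omega> - S n \<omega>\<bar>) < e" .
      moreover have "0 \<le> expectation (\<lambda>\<omega>. min 1 \<bar>T n \<omega> - S n \<omega>\<bar>)"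
        by (intro Bochner_Integration.integral_nonneg) auto
      ultimately show ?case by simp
    qed
  qed
  from weak_conv_m_perturb[OF S_meas T_meas real_dist_normal_dist clt this]
  show ?thesis
    unfolding V_eq T_def N_def h_def .
qed

end
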